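(* Let $R$ be an atomic integral domain which satisfies the principal containment (PC) condition, i.e. every proper two-generated ideal of $R$ is contained in a proper principal ideal of $R$. Then $R$ is a principal ideal domain.
   Context: All rings are integral domains (commutative with identity). A non-zero non-unit element $x$ of an integral domain $R$ is an atom (irreducible) if $x=yz$ with $y,z\in R$ implies that $y$ or $z$ is a unit. $R$ is atomic if every non-zero non-unit element of $R$ is a finite product of atoms. An ideal $I$ of $R$ is two-generated if $I=(a,b)$ for some $a,b\in R$ (not necessarily distinct or non-zero). $R$ satisfies the principal containment condition (is a PC domain) if every proper two-generated ideal of $R$ is contained in a proper principal ideal of $R$. $R$ is a principal ideal domain if every ideal of $R$ is principal. *)

theory Defs
  imports "HOL-Algebra.Ring_Divisibility"
begin

text \<open>
  Atoms are the elements satisfying the library predicate \<^const>\<open>ring_irreducible\<close>, which is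
  phrased through proper factors; in a domain it is the usual condition on factorizations
  into two factors:
\<close>

lemma (in domain) ring_irreducible_iff_factorization:
  assumes "x \<in> carrier R"
  shows "ring_irreducible x \<longleftrightarrow>
    x \<noteq> \<zero> \<and> x \<notin> Units R \<and>
    (\<forall>y\<in>carrier R. \<forall>z\<in>carrier R. x = y \<otimes> z \<longrightarrow> y \<in> Units R \<or> z \<in> Units R)"
  using assms ring_irreducibleE[of x] ring_irreducibleI[of x] by blast

locale atomic_domain = "domain" +
  assumes atomic: "\<lbrakk> x \<in> carrier R; x \<noteq> \<zero>; x \<notin> Units R \<rbrakk> \<Longrightarrow>
    \<exists>fs. set fs \<subseteq> carrier R \<and> (\<forall>p \<in> set fs. ring_irreducible p) \<and> x = foldr (\<otimes>) fs \<one>"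

definition two_generated_ideal :: "'a set \<Rightarrow> ('a, 'b) ring_scheme \<Rightarrow> bool"
  where "two_generated_ideal I R \<longleftrightarrow>
    (\<exists>a \<in> carrier R. \<exists>b \<in> carrier R. I = Idl\<^bsub>R\<^esub> {a, b})"

text \<open>An ideal is proper when it is not the whole ring; the zero ideal counts as proper.\<close>

locale pc_domain = "domain" +
  assumes principal_containment: "\<lbrakk> two_generated_ideal I R; I \<noteq> carrier R \<rbrakk> \<Longrightarrow>
    \<exists>J. principalideal J R \<and> J \<noteq> carrier R \<and> I \<subseteq> J"

end

theory Submission
  imports Defs
begin

text \<open>
  By principal containment, an atom \<open>p\<close> and an element it does not divide generate the unit ideal,
  since a proper principal ideal containing \<open>p\<close> is \<open>(p)\<close> itself. Now let an ideal \<open>I\<close> contain a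
  product \<open>p x\<close> of \<open>n + 1\<close> atoms, with \<open>x\<close> a product of \<open>n\<close> atoms. If some element of \<open>I\<close> is not
  divisible by \<open>p\<close>, it is comaximal with \<open>p\<close>, whence \<open>x \<in> I\<close>; otherwise \<open>I = p (I : p)\<close>, and
  \<open>x \<in> (I : p)\<close>. Either way induction on \<open>n\<close> shows that \<open>I\<close> is principal.
\<close>

text \<open>The colon ideal \<open>(I : c)\<close> serves twice: with \<open>c = x\<close> it turns
  comaximality of \<open>p\<close> and \<open>y\<close> into \<open>x \<in> I\<close>; with
  \<open>c = p\<close> it is the ideal passed to the induction hypothesis.\<close>

lemma (in cring) colon_ideal:
  assumes "ideal I R" "c \<in> carrier R"
  shows "ideal {r \<in> carrier R. c \<otimes> r \<in> I} R"
proof -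
  interpret I: ideal I R by fact
  show ?thesis
  proof (rule idealI[OF ring_axioms])
    show "subgroup {r \<in> carrier R. c \<otimes> r \<in> I} (add_monoid R)"
      using assms(2) by (intro add.subgroupI) (auto simp: r_distr r_minus)
  next
    fix a x assume a: "a \<in> {r \<in> carrier R. c \<otimes> r \<in> I}" and x: "x \<in> carrier R"
    then show "x \<otimes> a \<in> {r \<in> carrier R. c \<otimes> r \<in> I}"
      using assms(2) I.I_l_closed[of "c \<otimes> a" x] by (simp add: m_lcomm)
    then show "a \<otimes> x \<in> {r \<in> carrier R. c \<otimes> r \<in> I}"
      using a x by (simp add: m_comm)
  qed
qed

lemma (in pc_domain) genideal_irreducible_eq_carrier:
  assumes p: "p \<in> carrier R" "ring_irreducible p"
    and y: "y \<in> carrier R" "\<not> p divides y"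
  shows "Idl {p, y} = carrier R"
proof (rule ccontr)
  assume "Idl {p, y} \<noteq> carrier R"
  moreover have "two_generated_ideal (Idl {p, y}) R"
    using p(1) y(1) unfolding two_generated_ideal_def by blast
  ultimately obtain J where J: "principalideal J R" "J \<noteq> carrier R" "Idl {p, y} \<subseteq> J"
    using principal_containment by blast
  obtain c where c: "c \<in> carrier R" "J = PIdl c"
    using principalideal.generate[OF J(1)] cgenideal_eq_genideal by metis
  have "p \<in> PIdl c" "y \<in> PIdl c"
    using J(3) c genideal_self[of "{p, y}"] p(1) y(1) by auto
  then obtain r s where r: "r \<in> carrier R" "p = r \<otimes> c" and s: "s \<in> carrier R" "y = s \<otimes> c"
    unfolding cgenideal_def by auto
  have "c \<notin> Units R"
    using J(2) c ideal_eq_carrier_iff by auto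
  \<comment> \<open>Irreducibility of \<open>p = r \<otimes> c\<close> leaves only \<open>r\<close>
    to be a unit, so \<open>c\<close> is an associate of \<open>p\<close> and \<open>p\<close>
    divides each multiple of \<open>c\<close>.\<close>
  then have "r \<in> Units R"
    using ring_irreducible_iff_factorization[OF p(1)] p(2) r c(1) by blast
  then have "inv r \<otimes> p = c"
    using r c(1) by (simp add: m_assoc[symmetric])
  then have "p divides c"
    using \<open>r \<in> Units R\<close> p(1) by (intro dividesI[of "inv r"]) (auto simp: m_comm)
  then have "p divides y"
    using s c(1) p(1) by (simp add: divides_prod_l)
  with y(2) show False by contradiction
qed

lemma (in pc_domain) principal_if_contains_atom_product:
  assumes "ideal I R" "set fs \<subseteq> carrier R" "\<forall>p \<in> set fs. ring_irreducible p"
    "foldr (\<otimes>) fs \<one> \<in> I"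
  shows "\<exists>a \<in> carrier R. I = PIdl a"
  using assms
\<comment> \<open>\<open>I\<close> must vary: if \<open>p\<close> divides all of \<open>I\<close>,
  the shorter product is only known to lie in \<open>(I : p)\<close>.\<close>
proof (induction fs arbitrary: I)
  case Nil
  then have "I = carrier R"
    using ideal.one_imp_carrier by fastforce
  then show ?case
    using ideal_eq_carrier_iff[of \<one>] by auto
next
  case (Cons p fs)
  define x where "x = foldr (\<otimes>) fs \<one>"
  interpret I: ideal I R by fact
  have p: "p \<in> carrier R" "ring_irreducible p" and x: "x \<in> carrier R" and px: "p \<otimes> x \<in> I"
    using Cons.prems multlist_closed[of fs] by (auto simp: x_def)
  show ?case
  proof (cases "\<exists>y \<in> I. \<not> p divides y")
    case True
    then obtain y where y: "y \<in> I" "\<not> p divides y" by blast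
    \<comment> \<open>\<open>(I : x)\<close> contains \<open>p\<close> because
      \<open>p \<otimes> x \<in> I\<close>, and \<open>y\<close> because \<open>y \<in> I\<close>;
      hence it contains \<open>\<one>\<close>.\<close>
    let ?K = "{r \<in> carrier R. x \<otimes> r \<in> I}"
    have "{p, y} \<subseteq> ?K"
      using p(1) x px y(1) I.I_l_closed[of y x] by (auto simp: m_comm)
    then have "Idl {p, y} \<subseteq> ?K"
      using genideal_minimal[OF colon_ideal[OF Cons.prems(1) x]] by blast
    moreover have "Idl {p, y} = carrier R"
      using genideal_irreducible_eq_carrier[OF p _ y(2)] y(1) by simp
    ultimately have "x \<otimes> \<one> \<in> I" by blast
    then show ?thesis
      using Cons.IH[OF Cons.prems(1)] Cons.prems x by (simp add: x_def)
  next
    case False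
    let ?J = "{r \<in> carrier R. p \<otimes> r \<in> I}"
    have "x \<in> ?J" using x px by simp
    then obtain a where a: "a \<in> carrier R" "?J = PIdl a"
      using Cons.IH[OF colon_ideal[OF Cons.prems(1) p(1)]] Cons.prems
      unfolding x_def by auto
    have "a \<in> ?J"
      using a cgenideal_self by blast
    then have "p \<otimes> a \<in> I" by simp
    then have "PIdl (p \<otimes> a) \<subseteq> I"
      using cgenideal_minimal[OF Cons.prems(1)] by blast
    moreover have "y \<in> PIdl (p \<otimes> a)" if "y \<in> I" for y
    proof -
      have "p divides y"
        using False that by blast
      then obtain r where r: "r \<in> carrier R" "y = p \<otimes> r"
        by (elim dividesE)
      \<comment> \<open>The quotient \<open>r\<close> lies in \<open>(I : p)\<close> since
        \<open>p \<otimes> r = y \<in> I\<close>.\<close>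
      then have "r \<in> PIdl a"
        using that a(2) by blast
      then obtain s where s: "s \<in> carrier R" "r = s \<otimes> a"
        unfolding cgenideal_def by blast
      then have "y = s \<otimes> (p \<otimes> a)"
        unfolding r(2) s(2) using p(1) a(1) by (simp add: m_lcomm)
      then show ?thesis
        using s(1) unfolding cgenideal_def by blast
    qed
    ultimately show ?thesis
      using p(1) a(1) by blast
  qed
qed

theorem theorem2p5:
  fixes R (structure)
  assumes "atomic_domain R" and "pc_domain R"
  shows "principal_domain R"
proof -
  interpret pc_domain R by fact
  interpret A: atomic_domain R by fact
  show ?thesis
  proof
    fix I assume I: "ideal I R"
    interpret I: ideal I R by fact
    show "\<exists>a \<in> carrier R. I = PIdl a"
    proof (cases "I = {\<zero>}")
      case True
      then show ?thesis
        using cgenideal_eq_genideal genideal_zero by auto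
    next
      case False
      then obtain x where x: "x \<in> I" "x \<noteq> \<zero>"
        using I.zero_closed by blast
      show ?thesis
      proof (cases "x \<in> Units R")
        case True
        \<comment> \<open>Atomicity says nothing about units; the empty product
          \<open>\<one>\<close> replaces the factorization.\<close>
        then have "\<one> \<in> I"
          using I.I_r_closed[OF x(1), of "inv x"] by simp
        then show ?thesis
          using principal_if_contains_atom_product[OF I, of "[]"] by simp
      next
        case False
        then show ?thesis
          using A.atomic[of x] x principal_if_contains_atom_product[OF I] by auto
      qed
    qed
  qed
qed

end
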